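(* Let $G$ be a finite simple digraph. Then $G$ is a partial $1$-DAG if and only if $G$ contains none of the digraphs $K_3$, $N_4$, $M_5$ as a directed minor.
   Context: All digraphs are finite and simple: no self-loops and no multiple (parallel) edges; a pair of opposite edges $(u,v)$ and $(v,u)$ is allowed. An edge $(u,v)$ goes from its tail $u$ to its head $v$. **$k$-DAGs.** For $k\ge 0$, the class of $k$-DAGs is defined recursively. (1) A complete digraph with $k$ vertices (all edges $(u,v)$, $u\ne v$, present) is a $k$-DAG. (2) A $k$-DAG with $n+1$ vertices can be constructed from a $k$-DAG $H$ with $n$ vertices by adding a new vertex $v$ and edges as follows: at most $k$ edges from $v$ to vertices of $H$ are added; and, if $X\subseteq V(H)$ is the set of heads of these edges, an edge from $u\in V(H)$ to $v$ is added if $(u,w)\in E(H)$ for all $w\in X\setminus\{u\}$ (if $X=\emptyset$ this condition holds for all $u\in V(H)$). A partial $k$-DAG is a subgraph of a $k$-DAG. **Directed minors.** In the following operations any resulting self-loops and multiple edges are removed. - Cycle contraction: for a directed cycle $C=\{v_1,\dots,v_l\}$ in $G$ (distinct vertices with $(v_i,v_{i+1})\in E(G)$ for $1\le i\le l-1$ and $(v_l,v_1)\in E(G)$), delete all vertices of $C$ and all edges incident with them, add a new vertex $w$, and for each $x\in V(G)\setminus C$ add $(x,w)$ if $(x,v_i)\in E(G)$ for some $i$, and add $(w,x)$ if $(v_i,x)\in E(G)$ for some $i$. - Out-contraction of an edge $(u,v)\in E(G)$: the new vertex set is $V(G)\setminus\{u\}$ and the new edge set is $(E(G)\cup\{(x,v):(x,u)\in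 E(G)\})\setminus\{(x,u),(u,x):x\in V(G)\}$. - In-contraction of an edge $(u,v)\in E(G)$: the new vertex set is $V(G)\setminus\{v\}$ and the new edge set is $(E(G)\cup\{(u,x):(v,x)\in E(G)\})\setminus\{(x,v),(v,x):x\in V(G)\}$. A digraph $H$ is a directed minor of $G$ if $H$ is isomorphic to a digraph obtained from $G$ by a (possibly empty) sequence of vertex deletions, edge deletions, cycle contractions, out-contractions and in-contractions, in any order. "$G$ contains $H$ as a directed minor" means that $H$ is a directed minor of $G$. **The three digraphs.** Write $x\leftrightarrow y$ for the presence of both edges $(x,y)$ and $(y,x)$. - $K_3$: the complete digraph on three vertices $\{1,2,3\}$, i.e. all six edges $(i,j)$, $i\neq j$. - $N_4$: vertices $1,2,3,4$; edges $1\leftrightarrow 2$, $2\leftrightarrow 3$, $3\leftrightarrow 4$, together with $(1,3)$ and $(4,2)$; no other edges. - $M_5$: vertices $1,2,3,4,5$; edges $1\leftrightarrow 2$, $2\leftrightarrow 3$, $3\leftrightarrow 4$, $4\leftrightarrow 5$, together with $(1,3)$ and $(5,3)$; no other edges. *)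

theory Defs
  imports "Graph_Theory.Graph_Theory"
begin

text \<open>
  Finite simple digraphs are the elements of the locale \<^locale>\<open>pair_digraph\<close>:
  finite, without loops, and without parallel arcs because an arc is a pair.
\<close>

inductive k_dag :: "nat \<Rightarrow> 'a pair_pre_digraph \<Rightarrow> bool" for k :: nat where
  complete: "complete_digraph k (with_proj G) \<Longrightarrow> k_dag k G"
| add_vertex:
    "k_dag k H \<Longrightarrow> v \<notin> pverts H \<Longrightarrow> X \<subseteq> pverts H \<Longrightarrow> card X \<le> k \<Longrightarrow>
     k_dag k \<lparr> pverts = insert v (pverts H),
               parcs = parcs H \<union> {(v, w) | w. w \<in> X}
                 \<union> {(u, v) | u. u \<in> pverts H \<and> (\<forall>w \<in> X - {u}. (u, w) \<in> parcs H)} \<rparr>"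

text \<open>
  The host graph lives on \<^typ>\<open>nat\<close> and is compared with \<open>G\<close> up to isomorphism, so that
  the notion does not depend on the number of elements of the vertex type of \<open>G\<close>.
\<close>

definition partial_k_dag :: "nat \<Rightarrow> 'a pair_pre_digraph \<Rightarrow> bool" where
  "partial_k_dag k G \<longleftrightarrow>
    (\<exists>G' H :: nat pair_pre_digraph. k_dag k H \<and>
       subgraph (with_proj G') (with_proj H) \<and> digraph_iso (with_proj G) (with_proj G'))"

definition delete_vertex :: "'a pair_pre_digraph \<Rightarrow> 'a \<Rightarrow> 'a pair_pre_digraph" where
  "delete_vertex G v =
    \<lparr> pverts = pverts G - {v}, parcs = {(x, y) \<in> parcs G. x \<noteq> v \<and> y \<noteq> v} \<rparr>"

definition delete_edge :: "'a pair_pre_digraph \<Rightarrow> 'a \<times> 'a \<Rightarrow> 'a pair_pre_digraph" where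
  "delete_edge G e = \<lparr> pverts = pverts G, parcs = parcs G - {e} \<rparr>"

definition contract_set :: "'a pair_pre_digraph \<Rightarrow> 'a set \<Rightarrow> 'a \<Rightarrow> 'a pair_pre_digraph" where
  "contract_set G C w =
    \<lparr> pverts = insert w (pverts G - C),
      parcs = {(x, y) \<in> parcs G. x \<notin> C \<and> y \<notin> C}
        \<union> {(x, w) | x. x \<in> pverts G - C \<and> (\<exists>c \<in> C. (x, c) \<in> parcs G)}
        \<union> {(w, x) | x. x \<in> pverts G - C \<and> (\<exists>c \<in> C. (c, x) \<in> parcs G)} \<rparr>"

text \<open>Subtracting \<^const>\<open>Id\<close> removes a loop \<open>(v, v)\<close> or \<open>(u, u)\<close> arising from \<open>u \<leftrightarrow> v\<close>.\<close>

definition out_contract :: "'a pair_pre_digraph \<Rightarrow> 'a \<Rightarrow> 'a \<Rightarrow> 'a pair_pre_digraph" where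
  "out_contract G u v =
    \<lparr> pverts = pverts G - {u},
      parcs = (parcs G \<union> {(x, v) | x. (x, u) \<in> parcs G})
        - ({(x, u) | x. x \<in> pverts G} \<union> {(u, x) | x. x \<in> pverts G}) - Id \<rparr>"

definition in_contract :: "'a pair_pre_digraph \<Rightarrow> 'a \<Rightarrow> 'a \<Rightarrow> 'a pair_pre_digraph" where
  "in_contract G u v =
    \<lparr> pverts = pverts G - {v},
      parcs = (parcs G \<union> {(u, x) | x. (v, x) \<in> parcs G})
        - ({(x, v) | x. x \<in> pverts G} \<union> {(v, x) | x. x \<in> pverts G}) - Id \<rparr>"

text \<open>
  In a cycle contraction the new vertex \<open>w\<close> only has to differ from the remaining vertices;
  it may reuse the name of a vertex of the cycle. The result is the same up to isomorphism,
  and a suitable \<open>w\<close> exists even if the vertex type is finite and exhausted by the graph.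
\<close>

inductive minor_step :: "'a pair_pre_digraph \<Rightarrow> 'a pair_pre_digraph \<Rightarrow> bool"
  for G :: "'a pair_pre_digraph" where
  delete_vertex: "v \<in> pverts G \<Longrightarrow> minor_step G (delete_vertex G v)"
| delete_edge: "e \<in> parcs G \<Longrightarrow> minor_step G (delete_edge G e)"
| cycle_contraction:
    "pre_digraph.cycle (with_proj G) p \<Longrightarrow> C = fst ` set p \<Longrightarrow> w \<notin> pverts G - C \<Longrightarrow>
     minor_step G (contract_set G C w)"
| out_contraction: "(u, v) \<in> parcs G \<Longrightarrow> minor_step G (out_contract G u v)"
| in_contraction: "(u, v) \<in> parcs G \<Longrightarrow> minor_step G (in_contract G u v)"

definition directed_minor :: "'b pair_pre_digraph \<Rightarrow> 'a pair_pre_digraph \<Rightarrow> bool" where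
  "directed_minor H G \<longleftrightarrow>
    (\<exists>G'. minor_step\<^sup>*\<^sup>* G G' \<and> digraph_iso (with_proj H) (with_proj G'))"

definition K3 :: "nat pair_pre_digraph" where
  "K3 = \<lparr> pverts = {1, 2, 3},
          parcs = {(1, 2), (2, 1), (2, 3), (3, 2), (1, 3), (3, 1)} \<rparr>"

definition N4 :: "nat pair_pre_digraph" where
  "N4 = \<lparr> pverts = {1, 2, 3, 4},
          parcs = {(1, 2), (2, 1), (2, 3), (3, 2), (3, 4), (4, 3), (1, 3), (4, 2)} \<rparr>"

definition M5 :: "nat pair_pre_digraph" where
  "M5 = \<lparr> pverts = {1, 2, 3, 4, 5},
          parcs = {(1, 2), (2, 1), (2, 3), (3, 2), (3, 4), (4, 3), (4, 5), (5, 4),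
                   (1, 3), (5, 3)} \<rparr>"

end

theory Submission
  imports Defs
begin

text \<open>
  Read backwards, the construction of a 1-DAG is an elimination process: repeatedly choose a
  vertex \<open>v\<close> with at most one out-neighbour, join every in-neighbour of \<open>v\<close> to that
  out-neighbour, and delete \<open>v\<close>. The partial 1-DAGs are exactly the digraphs that this process
  can empty (\<open>partial_k_dag_iff_eliminable\<close>), whatever choices are made along the way.

  No 1-DAG contains an obstruction because such \<^emph>\<open>eliminable\<close> digraphs are closed under
  directed minors, while in \<open>K3\<close>, \<open>N4\<close> and \<open>M5\<close> every vertex has two out-neighbours, so that
  the process cannot even start. Up to arc deletions, an out-contraction is itself the
  elimination of a vertex with one out-neighbour, and eliminations commute
  (\<open>eliminable_bypass\<close>). A cycle contraction and an in-contraction both merge a set of vertices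
  all of whose entry points reach the whole set from within; this property persists when
  vertices inside or outside the set are eliminated, so an elimination of the digraph induces
  one of the contracted digraph (\<open>eliminable_merged\<close>).

  For the converse, take a minimal minor \<open>M\<close> that is not eliminable. All out-neighbourhoods of
  \<open>M\<close> have at least two elements, as otherwise an elimination step would be a minor operation
  leading to a smaller digraph of the same kind, and then exactly two, as otherwise an arc could
  be deleted. Contracting an arc must create a vertex with fewer than two out-neighbours;
  this forces out-neighbourhoods of a prescribed form around every arc, recorded in the locale
  \<open>critical_relation\<close>. Its main consequence (\<open>partner\<close>) is that an arc \<open>(u, v)\<close>
  without a reverse arc comes with a vertex \<open>x\<close> such that \<open>u \<leftrightarrow> x\<close> and \<open>u\<close>, \<open>x\<close> have \<open>v\<close> as
  their other out-neighbour. The proof is a counting argument: the arcs violating this are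
  mapped injectively, hence surjectively, into themselves, and then successors of such arcs form
  an impossible pattern. Starting from \<open>u\<close>, \<open>x\<close>, \<open>v\<close>, the path
  of two-way arcs \<open>u \<leftrightarrow> x \<leftrightarrow> v \<leftrightarrow> \<dots>\<close> is then seen to close up after four or five vertices, and
  these vertices, which have no arcs to the outside, induce \<open>N4\<close> or \<open>M5\<close>. If all arcs have a
  reverse arc, a triangle appears instead.
\<close>

section \<open>Elimination of vertices with at most one out-neighbour\<close>
definition bypass :: "'a \<Rightarrow> 'a rel \<Rightarrow> 'a rel" where
  "bypass v E = E \<union> {(x, y). (x, v) \<in> E \<and> (v, y) \<in> E}"

text \<open>
  Only the arcs between distinct elements of \<open>V\<close> count. Loops and arcs with an end outside
  \<open>V\<close> are tolerated, so an elimination step need not remove the arcs at \<open>v\<close> and two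
  elimination steps commute literally.
\<close>
inductive eliminable :: "'a set \<Rightarrow> 'a rel \<Rightarrow> bool" where
  empty: "eliminable {} E"
| eliminate: "v \<in> V \<Longrightarrow> V \<inter> E `` {v} \<subseteq> {v, w} \<Longrightarrow> eliminable (V - {v}) (bypass v E) \<Longrightarrow>
    eliminable V E"

lemma in_bypass: "(x, y) \<in> bypass v E \<longleftrightarrow> (x, y) \<in> E \<or> (x, v) \<in> E \<and> (v, y) \<in> E"
  by (auto simp: bypass_def)

lemma bypass_commute: "bypass a (bypass v E) = bypass v (bypass a E)"
  by (auto simp: in_bypass)

text \<open>
  An elimination order of a digraph, restricted to the image of an injective homomorphism into
  it, is one of the source. This yields monotonicity under subgraphs and invariance under
  isomorphism at once.
\<close>
lemma eliminable_pullback: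
  assumes "eliminable V E" "inj_on g V'" "g ` V' \<subseteq> V"
    and "\<And>x y. x \<in> V' \<Longrightarrow> y \<in> V' \<Longrightarrow> x \<noteq> y \<Longrightarrow> (x, y) \<in> E' \<Longrightarrow> (g x, g y) \<in> E"
  shows "eliminable V' E'"
  using assms
proof (induction arbitrary: V' E' rule: eliminable.induct)
  case (empty E)
  then show ?case by (auto intro: eliminable.empty)
next
  case (eliminate v V E w)
  show ?case
  proof (cases "v \<in> g ` V'")
    case False
    then show ?thesis
      using eliminate.prems by (intro eliminate.IH) (auto simp: in_bypass)
  next
    case True
    then obtain u where u: "u \<in> V'" "v = g u" by blast
    have "\<exists>z. V' \<inter> E' `` {u} \<subseteq> {u, z}"
    proof (cases "\<exists>z \<in> V'. z \<noteq> u \<and> (u, z) \<in> E'")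
      case True
      then obtain z where z: "z \<in> V'" "z \<noteq> u" "(u, z) \<in> E'" by blast
      have w: "g y = w" if "y \<in> V'" "y \<noteq> u" "(u, y) \<in> E'" for y
      proof -
        have "g y \<in> V \<inter> E `` {v}" using that u eliminate.prems by auto
        moreover have "g y \<noteq> v" using that u eliminate.prems(1) by (auto dest: inj_onD)
        ultimately show ?thesis using eliminate.hyps(2) by blast
      qed
      have "V' \<inter> E' `` {u} \<subseteq> {u, z}"
        using w z eliminate.prems(1) by (auto simp: inj_on_def)
      then show ?thesis ..
    qed auto
    then obtain z where z: "V' \<inter> E' `` {u} \<subseteq> {u, z}" ..
    have "eliminable (V' - {u}) (bypass u E')"
    proof (rule eliminate.IH)
      show "inj_on g (V' - {u})" using eliminate.prems(1) by (rule inj_on_diff)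
      show "g ` (V' - {u}) \<subseteq> V - {v}"
        using eliminate.prems(1,2) u by (auto dest: inj_onD)
      show "(g x, g y) \<in> bypass v E"
        if "x \<in> V' - {u}" "y \<in> V' - {u}" "x \<noteq> y" "(x, y) \<in> bypass u E'" for x y
        using that u eliminate.prems(3) by (auto simp: in_bypass)
    qed
    then show ?thesis using u z by (blast intro: eliminable.eliminate)
  qed
qed

lemma eliminable_mono:
  assumes "eliminable V E" "V' \<subseteq> V"
    and "\<And>x y. x \<in> V' \<Longrightarrow> y \<in> V' \<Longrightarrow> x \<noteq> y \<Longrightarrow> (x, y) \<in> E' \<Longrightarrow> (x, y) \<in> E"
  shows "eliminable V' E'"
  using assms by (intro eliminable_pullback[OF assms(1), of id]) auto

text \<open>
  Any admissible first choice can be completed: if the given order starts with another vertex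
  \<open>v\<close>, then \<open>a\<close> remains admissible after \<open>v\<close>, \<open>v\<close> remains admissible after \<open>a\<close>, and the two
  eliminations commute. The roles of \<open>b\<close> and \<open>w\<close> change when \<open>v\<close> or \<open>a\<close> is itself the unique
  out-neighbour of the other.
\<close>
lemma eliminable_bypass:
  assumes "eliminable V E" "a \<in> V" "V \<inter> E `` {a} \<subseteq> {a, b}"
  shows "eliminable (V - {a}) (bypass a E)"
  using assms
proof (induction arbitrary: b rule: eliminable.induct)
  case (empty E)
  then show ?case by simp
next
  case (eliminate v V E w)
  show ?case
  proof (cases "v = a")
    case False
    \<comment> \<open>If \<open>a\<close> had its arc to \<open>v\<close>, that arc now goes to the out-neighbour \<open>w\<close> of \<open>v\<close>.\<close>
    have "(V - {v}) \<inter> bypass v E `` {a} \<subseteq> {a, if b = v then w else b}"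
      using eliminate.hyps eliminate.prems False by (auto simp: in_bypass)
    then have "eliminable (V - {v} - {a}) (bypass a (bypass v E))"
      using eliminate.IH eliminate.prems(1) False by blast
    moreover have "V - {v} - {a} = V - {a} - {v}" by blast
    ultimately have *: "eliminable (V - {a} - {v}) (bypass v (bypass a E))"
      by (simp only: bypass_commute)
    have "(V - {a}) \<inter> bypass a E `` {v} \<subseteq> {v, if w = a then b else w}"
      using eliminate.hyps eliminate.prems False by (auto simp: in_bypass)
    then show ?thesis
      using * False eliminate.hyps(1) by (blast intro: eliminable.eliminate)
  qed (use eliminate in simp)
qed

section \<open>Merging a set of vertices\<close>
definition reaches_all :: "'a rel \<Rightarrow> 'a set \<Rightarrow> 'a \<Rightarrow> bool" where
  "reaches_all E C r \<longleftrightarrow> r \<in> C \<and> (\<forall>c \<in> C. (r, c) \<in> (E \<inter> C \<times> C)\<^sup>*)"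

lemma reaches_all_bypass_outside:
  assumes "reaches_all E C r" shows "reaches_all (bypass v E) C r"
proof -
  have "(E \<inter> C \<times> C)\<^sup>* \<subseteq> (bypass v E \<inter> C \<times> C)\<^sup>*"
    by (rule rtrancl_mono) (auto simp: in_bypass)
  then show ?thesis using assms by (auto simp: reaches_all_def)
qed

text \<open>A path through the eliminated vertex \<open>v\<close> is rerouted along the new arcs.\<close>
lemma reaches_all_bypass_inside:
  assumes "reaches_all E C r" "r \<noteq> v" shows "reaches_all (bypass v E) (C - {v}) r"
proof -
  let ?R = "(bypass v E \<inter> (C - {v}) \<times> (C - {v}))\<^sup>*"
  have "if c = v then \<exists>x \<in> C - {v}. (r, x) \<in> ?R \<and> (x, v) \<in> E else (r, c) \<in> ?R"
    if "(r, c) \<in> (E \<inter> C \<times> C)\<^sup>*" for c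
    using that
  proof induction
    case base
    then show ?case using assms(2) by simp
  next
    case (step y z)
    consider "y = v" "z = v" | "y = v" "z \<noteq> v" | "y \<noteq> v" "z = v" | "y \<noteq> v" "z \<noteq> v" by blast
    then show ?case
    proof cases
      case 2
      then obtain x where "x \<in> C - {v}" "(r, x) \<in> ?R" "(x, v) \<in> E" using step.IH by auto
      then have "(x, z) \<in> bypass v E \<inter> (C - {v}) \<times> (C - {v})"
        using 2 step.hyps by (auto simp: in_bypass)
      then show ?thesis using \<open>(r, x) \<in> ?R\<close> 2 by (auto intro: rtrancl_into_rtrancl)
    next
      case 4
      then have "(y, z) \<in> bypass v E \<inter> (C - {v}) \<times> (C - {v})"
        using step.hyps by (auto simp: in_bypass)
      then show ?thesis using step.IH 4 by (auto intro: rtrancl_into_rtrancl)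
    qed (use step in auto)
  qed
  then show ?thesis using assms by (fastforce simp: reaches_all_def)
qed

lemma reaches_all_leaves:
  assumes "reaches_all E C r" "c \<in> C" "c \<noteq> r"
  obtains x where "x \<in> C" "(r, x) \<in> E" "x \<noteq> r"
proof -
  have "(r, c) \<in> (E \<inter> C \<times> C)\<^sup>*" using assms by (auto simp: reaches_all_def)
  then have "c = r \<or> (\<exists>x \<in> C. (r, x) \<in> E \<and> x \<noteq> r)"
    by induction auto
  then show ?thesis using assms that by auto
qed

lemma reaches_all_enters:
  assumes "reaches_all E C r" "v \<in> C" "v \<noteq> r"
  obtains x where "x \<in> C" "(x, v) \<in> E" "x \<noteq> v"
proof -
  have "(r, v) \<in> (E \<inter> C \<times> C)\<^sup>*" using assms by (auto simp: reaches_all_def)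
  then have "v = r \<or> (\<exists>x \<in> C. (x, v) \<in> E \<and> x \<noteq> v)"
  proof induction
    case (step y z)
    then show ?case by (cases "y = z") auto
  qed simp
  then show ?thesis using assms that by auto
qed

text \<open>
  If \<open>v\<close> itself is eliminated, its only out-neighbour inherits the ability to reach
  all of \<open>C\<close>, since every path from \<open>v\<close> continues there.
\<close>
lemma reaches_all_bypass_root:
  assumes "reaches_all E C v" "C \<inter> E `` {v} \<subseteq> {v, w}" "w \<in> C - {v}"
  shows "reaches_all (bypass v E) (C - {v}) w"
proof -
  let ?R = "(bypass v E \<inter> (C - {v}) \<times> (C - {v}))\<^sup>*"
  have "c = v \<or> (w, c) \<in> ?R" if "(v, c) \<in> (E \<inter> C \<times> C)\<^sup>*" for c
    using that
  proof induction
    case (step y z)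
    then consider "z = v" | "y = v" "z = w" | "y \<noteq> v" "z \<noteq> v" using assms(2) by auto
    then show ?case
    proof cases
      case 3
      then have "(y, z) \<in> bypass v E \<inter> (C - {v}) \<times> (C - {v})"
        using step.hyps by (auto simp: in_bypass)
      then show ?thesis using step.IH 3 by (auto intro: rtrancl_into_rtrancl)
    qed auto
  qed simp
  then show ?thesis using assms by (auto simp: reaches_all_def)
qed

text \<open>
  The name \<open>m\<close> of the merged vertex is excluded in the first part because \<open>E\<close> may have stray
  arcs at a vertex that is also called \<open>m\<close>.
\<close>
definition merged :: "'a rel \<Rightarrow> 'a set \<Rightarrow> 'a \<Rightarrow> 'a rel" where
  "merged E C m = {(x, y). x \<notin> insert m C \<and> y \<notin> insert m C \<and> (x, y) \<in> E}
     \<union> {(x, m) | x. x \<notin> C \<and> (\<exists>c \<in> C. (x, c) \<in> E)}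
     \<union> {(m, x) | x. x \<notin> C \<and> (\<exists>c \<in> C. (c, x) \<in> E)}"

text \<open>
  The common core of cycle contraction (where every vertex of \<open>C\<close> reaches all of \<open>C\<close>) and of
  in-contraction of \<open>(u, v)\<close> (where \<open>C = {u, v}\<close>, and after arc deletions \<open>C\<close> can be entered
  at \<open>u\<close> only). Follow the given elimination order in the merged digraph. A vertex outside \<open>C\<close>
  is eliminated as before. A vertex \<open>v\<close> of \<open>C\<close> is simply dropped from \<open>C\<close> as long as
  others remain: arcs entering \<open>v\<close> from outside survive because then \<open>v\<close> has its out-neighbour
  in \<open>C\<close>, and an arc leaving \<open>C\<close> from \<open>v\<close> survives because some other vertex of \<open>C\<close> has an
  arc to \<open>v\<close>. The last vertex of \<open>C\<close> is eliminated as the merged vertex.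
\<close>
lemma eliminable_merged:
  assumes "eliminable V E" "C \<subseteq> V" "reaches_all E C r"
    and "\<And>x c. x \<in> V - C \<Longrightarrow> c \<in> C \<Longrightarrow> (x, c) \<in> E \<Longrightarrow> reaches_all E C c"
    and "m \<notin> V - C"
  shows "eliminable (insert m (V - C)) (merged E C m)"
  using assms
proof (induction arbitrary: C r rule: eliminable.induct)
  case (empty E)
  then show ?case by (simp add: reaches_all_def)
next
  case (eliminate v V E w)
  note out = eliminate.hyps(2) and sub = eliminate.prems(1) and root = eliminate.prems(2)
    and entry = eliminate.prems(3) and m = eliminate.prems(4)
  consider "v \<notin> C" | "v \<in> C" "C \<noteq> {v}" | "C = {v}" by blast
  then show ?case
  proof cases
    case 1
    have IH: "eliminable (insert m (V - {v} - C)) (merged (bypass v E) C m)"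
    proof (rule eliminate.IH)
      show "C \<subseteq> V - {v}" using sub 1 by blast
      show "reaches_all (bypass v E) C r" using root by (rule reaches_all_bypass_outside)
      show "reaches_all (bypass v E) C c" if "x \<in> V - {v} - C" "c \<in> C" "(x, c) \<in> bypass v E" for x c
        using that entry[of x c] entry[of v c] 1 eliminate.hyps(1)
        by (auto simp: in_bypass intro: reaches_all_bypass_outside)
      show "m \<notin> V - {v} - C" using m by blast
    qed
    have vm: "v \<noteq> m" using m 1 eliminate.hyps(1) by blast
    have step: "(x, y) \<in> merged (bypass v E) C m" if "x \<noteq> y" "(x, y) \<in> bypass v (merged E C m)" for x y
      using that vm 1 by (auto simp: in_bypass merged_def)
    have *: "eliminable (insert m (V - C) - {v}) (bypass v (merged E C m))"
      by (rule eliminable_mono[OF IH]) (use step in auto)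
    have "v \<in> insert m (V - C)" using 1 eliminate.hyps(1) by blast
    moreover have "insert m (V - C) \<inter> merged E C m `` {v} \<subseteq> {v, if w \<in> C then m else w}"
    proof
      fix y assume y: "y \<in> insert m (V - C) \<inter> merged E C m `` {v}"
      show "y \<in> {v, if w \<in> C then m else w}"
      proof (cases "y = m")
        case True
        then obtain c where "c \<in> C" "(v, c) \<in> E" using y vm by (auto simp: merged_def)
        then have "w \<in> C" using out sub 1 by blast
        then show ?thesis using True by simp
      next
        case False
        then have "(v, y) \<in> E" "y \<in> V - C" using y vm by (simp_all add: merged_def)
        then show ?thesis using out by auto
      qed
    qed
    ultimately show ?thesis using * by (rule eliminable.eliminate)
  next
    case 2
    have leave: "w \<in> C - {v} \<and> (v, w) \<in> E" if root_v: "reaches_all E C v"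
    proof -
      obtain c where "c \<in> C" "c \<noteq> v" using 2 by blast
      then obtain x where "x \<in> C" "(v, x) \<in> E" "x \<noteq> v"
        using reaches_all_leaves[OF root_v] by metis
      then show ?thesis using out sub by blast
    qed
    have new_root: "reaches_all (bypass v E) (C - {v}) w" if "reaches_all E C v"
      using reaches_all_bypass_root[OF that, of w] leave[OF that] out sub by blast
    have IH: "eliminable (insert m (V - {v} - (C - {v}))) (merged (bypass v E) (C - {v}) m)"
    proof (rule eliminate.IH)
      show "C - {v} \<subseteq> V - {v}" using sub by blast
      show "reaches_all (bypass v E) (C - {v}) (if r = v then w else r)"
        using root new_root reaches_all_bypass_inside[OF root] by (cases "r = v") simp_all
      show "reaches_all (bypass v E) (C - {v}) c"
        if "x \<in> V - {v} - (C - {v})" "c \<in> C - {v}" "(x, c) \<in> bypass v E" for x c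
      proof -
        have x: "x \<in> V - C" using that 2 by blast
        from that(3) consider "(x, c) \<in> E" | "(x, v) \<in> E" "(v, c) \<in> E" by (auto simp: in_bypass)
        then show ?thesis
        proof cases
          case 1
          then have "reaches_all E C c" using entry[OF x, of c] that(2) by simp
          then show ?thesis by (rule reaches_all_bypass_inside) (use that(2) in simp)
        next
          case 2
          then have "c = w" using that out sub by blast
          then show ?thesis using new_root[OF entry[OF x \<open>v \<in> C\<close> 2(1)]] by simp
        qed
      qed
      show "m \<notin> V - {v} - (C - {v})" using m 2 by blast
    qed
    have step: "(x, y) \<in> merged (bypass v E) (C - {v}) m"
      if "x \<in> insert m (V - C)" "y \<in> insert m (V - C)" "x \<noteq> y" "(x, y) \<in> merged E C m" for x y
    proof -
      note xy = that
      consider "x \<noteq> m" "y \<noteq> m" "(x, y) \<in> E" "x \<notin> C" "y \<notin> C"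
        | c where "y = m" "x \<notin> C" "c \<in> C" "(x, c) \<in> E"
        | c where "x = m" "y \<notin> C" "c \<in> C" "(c, y) \<in> E"
        using xy(4) unfolding merged_def by blast
      then show ?thesis
      proof cases
        case 1
        then show ?thesis by (auto simp: merged_def in_bypass)
      next
        case 2
        have "\<exists>c' \<in> C - {v}. (x, c') \<in> bypass v E"
        proof (cases "c = v")
          case True
          then have "reaches_all E C v" using entry[of x v] 2 that(1,3) by auto
          then show ?thesis using leave True 2 by (auto simp: in_bypass)
        qed (use 2 in \<open>auto simp: in_bypass\<close>)
        then show ?thesis using 2 by (auto simp: merged_def)
      next
        case 3
        have "\<exists>c' \<in> C - {v}. (c', y) \<in> bypass v E"
        proof (cases "c = v")
          case True
          then have "y = w" using that 3 out \<open>v \<in> C\<close> by blast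
          then have "r \<noteq> v" using leave root 3 by blast
          then obtain x where "x \<in> C" "(x, v) \<in> E" "x \<noteq> v"
            using reaches_all_enters[OF root] 2 by metis
          then show ?thesis using True 3 by (auto simp: in_bypass)
        qed (use 3 in \<open>auto simp: in_bypass\<close>)
        then show ?thesis using 3 by (auto simp: merged_def)
      qed
    qed
    show ?thesis
      by (rule eliminable_mono[OF IH]) (use 2 step in auto)
  next
    case 3
    have "eliminable (insert m (V - C) - {m}) (bypass m (merged E C m))"
      using eliminate.hyps(3)
      by (rule eliminable_mono) (use 3 m in \<open>auto simp: in_bypass merged_def\<close>)
    moreover have "insert m (V - C) \<inter> merged E C m `` {m} \<subseteq> {m, w}"
      using 3 out m by (auto simp: merged_def)
    ultimately show ?thesis by (blast intro: eliminable.eliminate)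
  qed
qed

section \<open>Eliminability is inherited by directed minors\<close>
lemma walk_connects:
  assumes "pcas u p v" "set p \<subseteq> E" "fst ` set p \<subseteq> C" "v \<in> C" "x \<in> insert v (fst ` set p)"
  shows "(u, x) \<in> (E \<inter> C \<times> C)\<^sup>* \<and> (x, v) \<in> (E \<inter> C \<times> C)\<^sup>*"
  using assms
proof (induction p arbitrary: u x)
  case Nil
  then show ?case by simp
next
  case (Cons e p)
  have walk: "fst e = u" "pcas (snd e) p v" "u \<in> C" "e \<in> E" using Cons.prems by auto
  have "snd e \<in> C" using walk Cons.prems by (cases p) auto
  then have first: "(u, snd e) \<in> E \<inter> C \<times> C" using walk by (cases e) auto
  have IH: "(snd e, y) \<in> (E \<inter> C \<times> C)\<^sup>* \<and> (y, v) \<in> (E \<inter> C \<times> C)\<^sup>*" if "y \<in> insert v (fst ` set p)" for y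
    using Cons.IH[of "snd e" y] walk Cons.prems that by auto
  have "(u, v) \<in> (E \<inter> C \<times> C)\<^sup>*" using first IH[of v] by (auto intro: converse_rtrancl_into_rtrancl)
  moreover have "x = u \<or> x \<in> insert v (fst ` set p)" using Cons.prems walk by auto
  ultimately show ?case using first IH[of x] by (auto intro: converse_rtrancl_into_rtrancl)
qed

lemma cycle_reaches_all:
  assumes "pre_digraph.cycle (with_proj G) p" "a \<in> fst ` set p"
  shows "reaches_all (parcs G) (fst ` set p) a"
proof -
  obtain u where u: "pcas u p u" "set p \<subseteq> parcs G" "p \<noteq> []"
    using assms(1) unfolding pre_digraph.cycle_def pre_digraph.awalk_def cas_with_proj_eq by auto
  then have "u \<in> fst ` set p" by (cases p) auto
  then have "(u, x) \<in> (parcs G \<inter> (fst ` set p) \<times> (fst ` set p))\<^sup>* \<and>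
      (x, u) \<in> (parcs G \<inter> (fst ` set p) \<times> (fst ` set p))\<^sup>*" if "x \<in> fst ` set p" for x
    using walk_connects[of u p u "parcs G" "fst ` set p" x] u that by auto
  then show ?thesis using assms(2) by (auto simp: reaches_all_def intro: rtrancl_trans)
qed

lemma pair_digraph_iff:
  "pair_digraph G \<longleftrightarrow>
    finite (pverts G) \<and> parcs G \<subseteq> pverts G \<times> pverts G \<and> (\<forall>v. (v, v) \<notin> parcs G)"
proof
  assume "pair_digraph G"
  then interpret pair_digraph G .
  show "finite (pverts G) \<and> parcs G \<subseteq> pverts G \<times> pverts G \<and> (\<forall>v. (v, v) \<notin> parcs G)"
    using pair_finite_verts in_arcsD1 in_arcsD2 pair_no_loops by fastforce
next
  assume *: "finite (pverts G) \<and> parcs G \<subseteq> pverts G \<times> pverts G \<and> (\<forall>v. (v, v) \<notin> parcs G)"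
  then have "finite (parcs G)" by (meson finite_SigmaI finite_subset)
  with * show "pair_digraph G" by unfold_locales auto
qed

lemma cycle_subset_verts:
  assumes "pair_digraph G" "pre_digraph.cycle (with_proj G) p"
  shows "fst ` set p \<subseteq> pverts G"
  using assms unfolding pre_digraph.cycle_def pre_digraph.awalk_def pair_digraph_iff by fastforce

lemma minor_step_pair_digraph:
  assumes "minor_step G G'" "pair_digraph G"
  shows "pair_digraph G'"
  using assms(1)
proof cases
  case (cycle_contraction p C w)
  then show ?thesis using assms(2) by (auto simp: pair_digraph_iff contract_set_def)
qed (use assms(2) in \<open>auto simp: pair_digraph_iff delete_vertex_def delete_edge_def
  out_contract_def in_contract_def\<close>)

lemma minor_steps_pair_digraph:
  assumes "minor_step\<^sup>*\<^sup>* G G'" "pair_digraph G"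
  shows "pair_digraph G'"
  using assms by induction (auto intro: minor_step_pair_digraph)

text \<open>
  For both arc contractions, first delete the arcs whose information the contraction discards:
  the other arcs leaving \<open>u\<close> for an out-contraction of \<open>(u, v)\<close>, the other arcs entering \<open>v\<close>
  for an in-contraction.
\<close>
lemma minor_step_eliminable:
  assumes "minor_step G G'" "pair_digraph G" "eliminable (pverts G) (parcs G)"
  shows "eliminable (pverts G') (parcs G')"
proof -
  have wf: "parcs G \<subseteq> pverts G \<times> pverts G" using assms(2) by (simp add: pair_digraph_iff)
  show ?thesis
    using assms(1)
  proof cases
    case (delete_vertex v)
    show ?thesis
      by (rule eliminable_mono[OF assms(3)]) (auto simp: delete_vertex delete_vertex_def)
  next
    case (delete_edge e)
    show ?thesis
      by (rule eliminable_mono[OF assms(3)]) (auto simp: delete_edge delete_edge_def)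
  next
    case (cycle_contraction p C w)
    obtain r where r: "r \<in> C"
      using cycle_contraction unfolding pre_digraph.cycle_def by (cases p) auto
    have "eliminable (insert w (pverts G - C)) (merged (parcs G) C w)"
      using assms(3)
      by (rule eliminable_merged[where r = r])
        (use cycle_contraction cycle_reaches_all[of G p] cycle_subset_verts[OF assms(2)] r in auto)
    then show ?thesis
      by (rule eliminable_mono)
        (use wf cycle_contraction(4) in \<open>auto simp: cycle_contraction(1) contract_set_def merged_def\<close>)
  next
    case (out_contraction u v)
    let ?E = "{(x, y) \<in> parcs G. x = u \<longrightarrow> y = v}"
    have "eliminable (pverts G) ?E"
      using assms(3) by (rule eliminable_mono) auto
    then have "eliminable (pverts G - {u}) (bypass u ?E)"
      by (rule eliminable_bypass[where b = v]) (use wf out_contraction in auto)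
    then show ?thesis
      by (rule eliminable_mono)
        (use out_contraction in \<open>auto simp: out_contraction out_contract_def in_bypass\<close>)
  next
    case (in_contraction u v)
    let ?E = "{(x, y) \<in> parcs G. y = v \<longrightarrow> x = u}"
    have uv: "u \<in> pverts G" "v \<in> pverts G" "u \<noteq> v"
      using in_contraction wf assms(2) by (auto simp: pair_digraph_iff)
    have "eliminable (pverts G) ?E"
      using assms(3) by (rule eliminable_mono) auto
    then have "eliminable (insert u (pverts G - {u, v})) (merged ?E {u, v} u)"
    proof (rule eliminable_merged)
      show root: "reaches_all ?E {u, v} u" using in_contraction by (auto simp: reaches_all_def)
      show "reaches_all ?E {u, v} c" if "x \<in> pverts G - {u, v}" "c \<in> {u, v}" "(x, c) \<in> ?E" for x c
        using that root by auto
    qed (use uv in auto)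
    then show ?thesis
      by (rule eliminable_mono)
        (use in_contraction uv in \<open>auto simp: in_contraction in_contract_def merged_def\<close>)
  qed
qed

lemma minor_steps_eliminable:
  assumes "minor_step\<^sup>*\<^sup>* G G'" "pair_digraph G" "eliminable (pverts G) (parcs G)"
  shows "eliminable (pverts G') (parcs G')"
  using assms by induction (auto intro: minor_step_eliminable minor_steps_pair_digraph)

section \<open>Branching digraphs and isomorphic copies\<close>

text \<open>The digraphs in which the elimination process cannot start.\<close>
definition branching :: "'a set \<Rightarrow> 'a rel \<Rightarrow> bool" where
  "branching V E \<longleftrightarrow> V \<noteq> {} \<and>
    (\<forall>v \<in> V. \<exists>a \<in> V. \<exists>b \<in> V. a \<noteq> b \<and> a \<noteq> v \<and> b \<noteq> v \<and> (v, a) \<in> E \<and> (v, b) \<in> E)"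

lemma branching_not_eliminable:
  assumes "branching V E" shows "\<not> eliminable V E"
proof
  assume "eliminable V E"
  then show False
  proof cases
    case (eliminate v w)
    then obtain a b where "a \<in> V" "b \<in> V" "a \<noteq> b" "a \<noteq> v" "b \<noteq> v" "(v, a) \<in> E" "(v, b) \<in> E"
      using assms unfolding branching_def by metis
    then show False using eliminate(2) by blast
  qed (use assms in \<open>simp add: branching_def\<close>)
qed

lemma pair_digraph_iso_iff:
  assumes "pair_digraph G"
  shows "digraph_iso (with_proj G) (with_proj H) \<longleftrightarrow>
    (\<exists>f. inj_on f (pverts G) \<and> pverts H = f ` pverts G \<and> parcs H = map_prod f f ` parcs G)"
    (is "?L \<longleftrightarrow> ?R")
proof -
  interpret pair_digraph G by fact
  show ?thesis
  proof
    assume ?L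
    then obtain h where h: "digraph_isomorphism h" "with_proj H = app_iso h (with_proj G)"
      by (auto simp: digraph_iso_def)
    let ?f = "iso_verts h"
    have verts: "pverts H = ?f ` pverts G" and arcs: "parcs H = iso_arcs h ` parcs G"
      and ends: "fst = iso_tail h" "snd = iso_head h"
      using h(2) by (metis with_proj_simps(1) app_iso_simps(1))
        (metis with_proj_simps(2,4,5) app_iso_simps(2-4) h(2))+
    have "iso_arcs h e = map_prod ?f ?f e" if "e \<in> parcs G" for e
      using h(1) that ends by (cases e) (fastforce simp: digraph_isomorphism_def intro: prod_eqI)
    then have "parcs H = map_prod ?f ?f ` parcs G" using arcs by force
    then show ?R using verts h(1) by (auto simp: digraph_isomorphism_def)
  next
    assume ?R
    then obtain f where f: "inj_on f (pverts G)" "pverts H = f ` pverts G"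
      "parcs H = map_prod f f ` parcs G" by blast
    let ?h = "\<lparr>iso_verts = f, iso_arcs = map_prod f f, iso_head = snd, iso_tail = fst\<rparr>"
    have "inj_on (map_prod f f) (parcs G)"
    proof (rule inj_onI)
      fix d e assume "d \<in> parcs G" "e \<in> parcs G" "map_prod f f d = map_prod f f e"
      then show "d = e"
        using f(1) arc_fst_in_verts arc_snd_in_verts
        by (metis fst_map_prod snd_map_prod inj_onD prod_eqI)
    qed
    then have "digraph_isomorphism ?h"
      using f(1) wf_digraph by (auto simp: digraph_isomorphism_def)
    moreover have "with_proj H = app_iso ?h (with_proj G)"
      using f by (simp add: app_iso_def with_proj_def)
    ultimately show ?L unfolding digraph_iso_def by blast
  qed
qed

lemma eliminable_iso:
  assumes "pair_digraph G" "digraph_iso (with_proj G) (with_proj H)"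
  shows "eliminable (pverts G) (parcs G) \<longleftrightarrow> eliminable (pverts H) (parcs H)"
proof -
  have wf: "parcs G \<subseteq> pverts G \<times> pverts G" using assms(1) by (simp add: pair_digraph_iff)
  obtain f where f: "inj_on f (pverts G)" "pverts H = f ` pverts G"
      "parcs H = map_prod f f ` parcs G"
    using assms(2) unfolding pair_digraph_iso_iff[OF assms(1)] by blast
  let ?g = "the_inv_into (pverts G) f"
  have g: "?g (f x) = x" if "x \<in> pverts G" for x
    using that f(1) by (rule the_inv_into_f_f[rotated])
  show ?thesis
  proof
    assume "eliminable (pverts G) (parcs G)"
    then show "eliminable (pverts H) (parcs H)"
      by (rule eliminable_pullback[where g = ?g])
        (use f g wf in \<open>auto simp: inj_on_the_inv_into\<close>)
  next
    assume "eliminable (pverts H) (parcs H)"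
    then show "eliminable (pverts G) (parcs G)"
      by (rule eliminable_pullback[where g = f]) (use f in auto)
  qed
qed

lemma branching_not_minor:
  assumes "pair_digraph K" "branching (pverts K) (parcs K)"
    and "pair_digraph G" "eliminable (pverts G) (parcs G)"
  shows "\<not> directed_minor K G"
  using assms branching_not_eliminable minor_steps_eliminable eliminable_iso
  unfolding directed_minor_def by metis

section \<open>Partial 1-DAGs are the eliminable digraphs\<close>
lemma k_dag_eliminable:
  assumes "k_dag 1 H"
  shows "finite (pverts H) \<and> parcs H \<subseteq> pverts H \<times> pverts H \<and> eliminable (pverts H) (parcs H)"
  using assms
proof induction
  case (complete G)
  then obtain v where v: "pverts G = {v}" "parcs G \<subseteq> {v} \<times> {v}"
    unfolding complete_digraph_pair_def by (auto simp: card_1_singleton_iff)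
  have "eliminable {v} (parcs G)"
    by (rule eliminable.eliminate[where v = v]) (auto intro: eliminable.empty)
  then show ?case using v by simp
next
  case (add_vertex H v X)
  let ?V = "insert v (pverts H)"
  let ?E = "parcs H \<union> {(v, w) | w. w \<in> X}
      \<union> {(u, v) | u. u \<in> pverts H \<and> (\<forall>w \<in> X - {u}. (u, w) \<in> parcs H)}"
  have "finite X" using add_vertex by (auto intro: finite_subset)
  with \<open>card X \<le> 1\<close> obtain w where X: "X \<subseteq> {w}"
    by (auto simp: card_le_Suc0_iff_eq) blast
  have "eliminable (?V - {v}) (bypass v ?E)"
    by (rule eliminable_mono[of "pverts H" "parcs H"])
      (use add_vertex in \<open>auto simp: in_bypass\<close>)
  then have "eliminable ?V ?E"
    by (rule eliminable.eliminate[where v = v and w = w, rotated 2])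
      (use add_vertex X in auto)
  then show ?case using add_vertex by auto
qed

text \<open>
  The elimination order is replayed backwards, with the out-neighbours of \<open>v\<close> as the set \<open>X\<close>.
  The arcs added by eliminating \<open>v\<close> say precisely that every in-neighbour of \<open>v\<close>
  satisfies the condition under which its arc to \<open>v\<close> is present in the 1-DAG.
\<close>
lemma eliminable_k_dag:
  assumes "eliminable V E" "V \<noteq> {}"
  shows "\<exists>H. k_dag 1 H \<and> pverts H = V \<and> parcs H \<subseteq> V \<times> V \<and>
    (\<forall>x \<in> V. \<forall>y \<in> V. x \<noteq> y \<longrightarrow> (x, y) \<in> E \<longrightarrow> (x, y) \<in> parcs H)"
  using assms
proof induction
  case (empty E)
  then show ?case by simp
next
  case (eliminate v V E w)
  show ?case
  proof (cases "V = {v}")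
    case True
    have "k_dag 1 \<lparr>pverts = {v}, parcs = {}\<rparr>"
      by (rule k_dag.complete) (auto simp: complete_digraph_pair_def)
    then show ?thesis using True by (intro exI[of _ "\<lparr>pverts = {v}, parcs = {}\<rparr>"]) auto
  next
    case False
    then have "V - {v} \<noteq> {}" using eliminate.hyps(1) by blast
    then obtain H where H: "k_dag 1 H" "pverts H = V - {v}" "parcs H \<subseteq> (V - {v}) \<times> (V - {v})"
      "\<forall>x \<in> V - {v}. \<forall>y \<in> V - {v}. x \<noteq> y \<longrightarrow> (x, y) \<in> bypass v E \<longrightarrow> (x, y) \<in> parcs H"
      using eliminate.IH by blast
    define X where "X = (V - {v}) \<inter> E `` {v}"
    have "X \<subseteq> {w}" using eliminate.hyps by (auto simp: X_def)
    then have "card X \<le> 1" using card_mono[of "{w}" X] by simp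
    let ?H = "\<lparr>pverts = insert v (pverts H), parcs = parcs H \<union> {(v, w) | w. w \<in> X}
      \<union> {(u, v) | u. u \<in> pverts H \<and> (\<forall>w \<in> X - {u}. (u, w) \<in> parcs H)}\<rparr>"
    have "k_dag 1 ?H"
      by (rule k_dag.add_vertex) (use H \<open>card X \<le> 1\<close> in \<open>auto simp: X_def\<close>)
    moreover have "(x, y) \<in> parcs ?H" if "x \<in> V" "y \<in> V" "x \<noteq> y" "(x, y) \<in> E" for x y
    proof -
      consider "x = v" | "y = v" | "x \<noteq> v" "y \<noteq> v" by blast
      then show ?thesis
      proof cases
        case 1
        then show ?thesis using that by (auto simp: X_def)
      next
        case 2
        have "(x, w) \<in> parcs H" if "w \<in> X - {x}" for w
          using that 2 \<open>x \<in> V\<close> \<open>x \<noteq> y\<close> \<open>(x, y) \<in> E\<close> H(4) by (auto simp: X_def in_bypass)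
        then show ?thesis using that H(2) 2 by auto
      next
        case 3
        then show ?thesis using that H(4) by (auto simp: in_bypass)
      qed
    qed
    ultimately show ?thesis
      using H eliminate.hyps(1) by (intro exI[of _ ?H]) (auto simp: X_def)
  qed
qed

lemma partial_k_dag_iff_eliminable:
  fixes G :: "'a pair_pre_digraph"
  assumes "pair_digraph G"
  shows "partial_k_dag 1 G \<longleftrightarrow> eliminable (pverts G) (parcs G)"
proof
  assume "partial_k_dag 1 G"
  then obtain G' H :: "nat pair_pre_digraph" where H: "k_dag 1 H"
    "subgraph (with_proj G') (with_proj H)" "digraph_iso (with_proj G) (with_proj G')"
    unfolding partial_k_dag_def by blast
  have "eliminable (pverts G') (parcs G')"
    using k_dag_eliminable[OF H(1)] H(2)
    by (auto simp: subgraph_def intro: eliminable_mono)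
  then show "eliminable (pverts G) (parcs G)" using eliminable_iso assms H(3) by blast
next
  assume elim: "eliminable (pverts G) (parcs G)"
  have G: "finite (pverts G)" "parcs G \<subseteq> pverts G \<times> pverts G" "\<And>v. (v, v) \<notin> parcs G"
    using assms by (auto simp: pair_digraph_iff)
  obtain f :: "'a \<Rightarrow> nat" where f: "inj_on f (pverts G)"
    using finite_imp_inj_to_nat_seg[OF G(1)] by blast
  define G' where "G' = \<lparr>pverts = f ` pverts G, parcs = map_prod f f ` parcs G\<rparr>"
  have iso: "digraph_iso (with_proj G) (with_proj G')"
    unfolding pair_digraph_iso_iff[OF assms] using f by (auto simp: G'_def)
  have G': "pair_digraph G'"
    using G f by (auto simp: G'_def pair_digraph_iff dest: inj_onD)
  then have wf: "wf_digraph (with_proj G')" by (simp add: pair_digraph_iff wf_digraph_def) force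
  have elim': "eliminable (pverts G') (parcs G')" using elim eliminable_iso[OF assms iso] by simp
  have "\<exists>H. k_dag 1 H \<and> parcs H \<subseteq> pverts H \<times> pverts H \<and> pverts G' \<subseteq> pverts H \<and> parcs G' \<subseteq> parcs H"
  proof (cases "pverts G' = {}")
    case True
    \<comment> \<open>There is no empty 1-DAG, but the empty digraph is a subgraph of a single vertex.\<close>
    have "k_dag 1 \<lparr>pverts = {0 :: nat}, parcs = {}\<rparr>"
      by (rule k_dag.complete) (auto simp: complete_digraph_pair_def)
    then show ?thesis using True G'
      by (intro exI[of _ "\<lparr>pverts = {0}, parcs = {}\<rparr>"]) (auto simp: pair_digraph_iff)
  next
    case False
    obtain H where "k_dag 1 H \<and> pverts H = pverts G' \<and> parcs H \<subseteq> pverts G' \<times> pverts G' \<and>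
        (\<forall>x \<in> pverts G'. \<forall>y \<in> pverts G'. x \<noteq> y \<longrightarrow> (x, y) \<in> parcs G' \<longrightarrow> (x, y) \<in> parcs H)"
      using eliminable_k_dag[OF elim' False] by blast
    moreover from G' have "x \<in> pverts G' \<and> y \<in> pverts G' \<and> x \<noteq> y" if "(x, y) \<in> parcs G'" for x y
      using that by (auto simp: pair_digraph_iff)
    ultimately show ?thesis by (intro exI[of _ H]) auto
  qed
  then obtain H where H: "k_dag 1 H" "parcs H \<subseteq> pverts H \<times> pverts H" "pverts G' \<subseteq> pverts H"
    "parcs G' \<subseteq> parcs H" by blast
  then have "subgraph (with_proj G') (with_proj H)"
    using wf by (auto simp: subgraph_def wf_digraph_def compatible_def)
  then show "partial_k_dag 1 G" unfolding partial_k_dag_def using H(1) iso by blast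
qed

section \<open>Out-closed copies\<close>
lemma minor_steps_restrict:
  assumes "pair_digraph G" "S \<subseteq> pverts G"
  shows "minor_step\<^sup>*\<^sup>* G \<lparr>pverts = S, parcs = parcs G \<inter> S \<times> S\<rparr>"
proof -
  have "minor_step\<^sup>*\<^sup>* G \<lparr>pverts = pverts G - D, parcs = parcs G \<inter> (pverts G - D) \<times> (pverts G - D)\<rparr>"
    if "finite D" "D \<subseteq> pverts G" for D
    using that
  proof (induction D rule: finite_induct)
    case empty
    have "\<lparr>pverts = pverts G, parcs = parcs G \<inter> pverts G \<times> pverts G\<rparr> = G"
      using assms(1) by (intro pair_pre_digraph.equality) (auto simp: pair_digraph_iff)
    then show ?case by simp
  next
    case (insert d D)
    let ?G = "\<lambda>D. \<lparr>pverts = pverts G - D, parcs = parcs G \<inter> (pverts G - D) \<times> (pverts G - D)\<rparr>"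
    have "delete_vertex (?G D) d = ?G (insert d D)"
      by (auto simp: delete_vertex_def)
    moreover have "minor_step (?G D) (delete_vertex (?G D) d)"
      by (rule minor_step.delete_vertex) (use insert in auto)
    ultimately show ?case
      using insert by (auto intro: rtranclp.rtrancl_into_rtrancl)
  qed
  from this[of "pverts G - S"] show ?thesis
    using assms by (simp add: pair_digraph_iff double_diff)
qed

text \<open>
  Since all out-neighbours of the image are prescribed, no arc leaves it, and it suffices to
  look at out-neighbourhoods to recognise an induced copy.
\<close>
definition closed_copy :: "'b pair_pre_digraph \<Rightarrow> 'a rel \<Rightarrow> bool" where
  "closed_copy K E \<longleftrightarrow>
    (\<exists>f. inj_on f (pverts K) \<and> (\<forall>i \<in> pverts K. E `` {f i} = f ` (parcs K `` {i})))"

lemma closed_copy_minor: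
  assumes "closed_copy K (parcs G)" "pair_digraph G" "pair_digraph K"
    and "\<And>i. i \<in> pverts K \<Longrightarrow> parcs K `` {i} \<noteq> {}"
  shows "directed_minor K G"
proof -
  have G: "parcs G \<subseteq> pverts G \<times> pverts G" and K: "parcs K \<subseteq> pverts K \<times> pverts K"
    using assms(2,3) by (auto simp: pair_digraph_iff)
  obtain f where f: "inj_on f (pverts K)"
    "\<And>i. i \<in> pverts K \<Longrightarrow> parcs G `` {f i} = f ` (parcs K `` {i})"
    using assms(1) by (auto simp: closed_copy_def)
  let ?S = "f ` pverts K"
  let ?H = "\<lparr>pverts = ?S, parcs = parcs G \<inter> ?S \<times> ?S\<rparr>"
  have "?S \<subseteq> pverts G"
  proof
    fix x assume "x \<in> ?S"
    then obtain i where i: "i \<in> pverts K" "x = f i" by blast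
    then have "parcs G `` {x} \<noteq> {}" using f(2) assms(4) by simp
    then show "x \<in> pverts G" using G by blast
  qed
  then have "minor_step\<^sup>*\<^sup>* G ?H" by (rule minor_steps_restrict[OF assms(2)])
  moreover have "parcs G \<inter> ?S \<times> ?S = map_prod f f ` parcs K"
  proof (intro equalityI subsetI)
    fix e assume e: "e \<in> parcs G \<inter> ?S \<times> ?S"
    then obtain i y where i: "i \<in> pverts K" "e = (f i, y)" by blast
    then have "y \<in> f ` (parcs K `` {i})" using e f(2)[OF i(1)] by blast
    then show "e \<in> map_prod f f ` parcs K" using i by force
  next
    fix e assume "e \<in> map_prod f f ` parcs K"
    then obtain i j where ij: "(i, j) \<in> parcs K" "e = (f i, f j)" by auto
    then have "i \<in> pverts K" "j \<in> pverts K" using K by auto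
    moreover have "f j \<in> parcs G `` {f i}" using f(2)[OF \<open>i \<in> pverts K\<close>] ij by blast
    ultimately show "e \<in> parcs G \<inter> ?S \<times> ?S" using ij by blast
  qed
  then have "digraph_iso (with_proj K) (with_proj ?H)"
    unfolding pair_digraph_iso_iff[OF assms(3)] using f(1) by (intro exI[of _ f]) simp
  ultimately show ?thesis unfolding directed_minor_def by blast
qed

section \<open>The local structure of a minimal non-eliminable digraph\<close>

text \<open>
  What minimality leaves to say about out-neighbourhoods. Each of the last three assumptions is
  the reason why a contraction is impossible: \<open>single\<close> for the out-contraction of an arc without a
  reverse arc, \<open>double\<close> for the contraction of a 2-cycle, and \<open>twin\<close> for identifying two
  vertices \<open>u \<leftrightarrow> v\<close> with their common third out-neighbour \<open>a\<close>.
\<close>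
locale critical_relation =
  fixes E :: "'a rel"
  assumes finite_E: "finite E"
    and irrefl: "(v, v) \<notin> E"
    and two_out: "(u, v) \<in> E \<Longrightarrow> \<exists>w. w \<noteq> v \<and> E `` {u} = {v, w}"
    and single: "(u, v) \<in> E \<Longrightarrow> (v, u) \<notin> E \<Longrightarrow> \<exists>x. E `` {x} = {u, v}"
    and double: "(u, v) \<in> E \<Longrightarrow> (v, u) \<in> E \<Longrightarrow>
      (\<exists>x. E `` {x} = {u, v}) \<or> E `` {u} - {v} = E `` {v} - {u}"
    and twin: "E `` {u} = {v, a} \<Longrightarrow> E `` {v} = {u, a} \<Longrightarrow>
      (a, u) \<in> E \<or> (a, v) \<in> E \<or> (\<exists>x. x \<notin> {u, v, a} \<and> E `` {x} \<noteq> {} \<and> E `` {x} \<subseteq> {u, v, a})"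
begin

lemma outE:
  assumes "(u, v) \<in> E"
  obtains w where "w \<noteq> v" "w \<noteq> u" "v \<noteq> u" "E `` {u} = {v, w}"
  using two_out[OF assms] irrefl assms by blast

lemma out_eq: "(u, v) \<in> E \<Longrightarrow> (u, w) \<in> E \<Longrightarrow> v \<noteq> w \<Longrightarrow> E `` {u} = {v, w}"
  using two_out by blast

text \<open>
  Let \<open>B\<close> be the set of violating arcs. By \<open>single\<close>, an arc \<open>(u, v)\<close> of \<open>B\<close> has some \<open>x\<close> with
  out-neighbours \<open>u\<close> and \<open>v\<close>, and then \<open>(x, u)\<close> belongs to \<open>B\<close> again. This map is injective as
  \<open>v\<close> is the out-neighbour of \<open>x\<close> other than \<open>u\<close>; as \<open>B\<close> is finite, it is onto. So every
  arc \<open>(u, v)\<close> of \<open>B\<close> can also be followed forwards to \<open>(v, w)\<close> in \<open>B\<close> with \<open>w\<close> an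
  out-neighbour of \<open>u\<close>. Two forward steps lead to \<open>u \<leftrightarrow> w\<close> with distinct further
  out-neighbours \<open>v\<close> and \<open>z\<close>, and \<open>double\<close> then asks for a vertex that cannot exist.
\<close>
lemma partner:
  assumes "(u, v) \<in> E" "(v, u) \<notin> E"
  shows "\<exists>x. E `` {x} = {u, v} \<and> E `` {u} = {x, v}"
proof (rule ccontr)
  assume contra: "\<not> ?thesis"
  define B where "B = {(u, v). (u, v) \<in> E \<and> (v, u) \<notin> E \<and> \<not> (\<exists>x. E `` {x} = {u, v} \<and> E `` {u} = {x, v})}"
  have BD: "(u, v) \<in> E" "(v, u) \<notin> E" if "(u, v) \<in> B" for u v using that by (auto simp: B_def)
  have BI: "\<exists>x. E `` {x} = {u, v} \<and> E `` {u} = {x, v}"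
    if "(u, v) \<in> E" "(v, u) \<notin> E" "(u, v) \<notin> B" for u v
    using that by (auto simp: B_def)
  have succ: "\<exists>x. E `` {x} = {u, v} \<and> (x, u) \<in> B" if uv: "(u, v) \<in> B" for u v
  proof -
    obtain x where x: "E `` {x} = {u, v}" using single BD[OF uv] by blast
    have single_xu: "(u, x) \<notin> E"
    proof
      assume "(u, x) \<in> E"
      moreover have "x \<noteq> v" using x irrefl by blast
      ultimately have "E `` {u} = {x, v}" using out_eq BD(1)[OF uv] by blast
      then show False using x uv by (auto simp: B_def)
    qed
    have "(x, u) \<in> B"
    proof (rule ccontr)
      assume "(x, u) \<notin> B"
      then obtain y where y: "E `` {y} = {x, u}" "E `` {x} = {y, u}"
        using BI[of x u] x single_xu by blast
      then have "y = v" using x irrefl by (metis doubleton_eq_iff)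
      then show False using y BD(2)[OF uv] by blast
    qed
    then show ?thesis using x by blast
  qed
  \<comment> \<open>The backward step on \<open>B\<close>, injective because its value determines \<open>u\<close> and the set \<open>{u, v}\<close>.\<close>
  define g where "g = (\<lambda>(u, v). (SOME x. E `` {x} = {u, v} \<and> (x, u) \<in> B, u))"
  have g: "\<exists>x. g (u, v) = (x, u) \<and> E `` {x} = {u, v} \<and> (x, u) \<in> B" if "(u, v) \<in> B" for u v
    using someI_ex[OF succ[OF that]] by (auto simp: g_def)
  have "finite B" by (rule finite_subset[OF _ finite_E]) (auto simp: B_def)
  moreover have "g ` B \<subseteq> B" using g by fastforce
  moreover have "inj_on g B"
  proof (rule inj_onI)
    fix d e assume "d \<in> B" "e \<in> B" and eq: "g d = g e"
    obtain u v u' v' where de: "d = (u, v)" "e = (u', v')" by (cases d, cases e)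
    then have "u = u'" "{u, v} = {u', v'}"
      using g[of u v] g[of u' v'] \<open>d \<in> B\<close> \<open>e \<in> B\<close> eq by auto
    then show "d = e" using de by (auto simp: doubleton_eq_iff)
  qed
  ultimately have surj: "g ` B = B" by (rule endo_inj_surj)
  have pred: "\<exists>w. E `` {u} = {v, w} \<and> (v, w) \<in> B" if "(u, v) \<in> B" for u v
  proof -
    from that surj obtain p w where "(p, w) \<in> B" "g (p, w) = (u, v)" by (metis imageE surj_pair)
    then show ?thesis using g[of p w] by auto
  qed
  have "(u, v) \<in> B" using assms contra by (simp add: B_def)
  then obtain w where w: "E `` {u} = {v, w}" "(v, w) \<in> B" using pred by blast
  then obtain z where z: "E `` {v} = {w, z}" "(w, z) \<in> B" using pred by blast
  have "v \<noteq> w" using w(2) BD irrefl by blast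
  have "(w, u) \<in> E"
  proof (rule ccontr)
    assume wu: "(w, u) \<notin> E"
    show False
    proof (cases "(u, w) \<in> B")
      case True
      then obtain w' where "E `` {u} = {w, w'}" "(w, w') \<in> B" using pred by blast
      then have "(w, v) \<in> B" using w(1) \<open>v \<noteq> w\<close> by (metis doubleton_eq_iff)
      then show False using BD w(2) by blast
    next
      case False
      then obtain y where "E `` {y} = {u, w}" "E `` {u} = {y, w}" using BI[of u w] w wu by blast
      then have "(v, u) \<in> E" using w(1) \<open>v \<noteq> w\<close> by (metis doubleton_eq_iff Image_singleton_iff insertI1)
      then show False using assms(2) by blast
    qed
  qed
  \<comment> \<open>Now \<open>u \<leftrightarrow> w\<close>, and their other out-neighbours \<open>v\<close> and \<open>z\<close> differ.\<close>
  moreover have "z \<noteq> u" using w(1) BD(2)[OF z(2)] by blast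
  ultimately have out_w: "E `` {w} = {u, z}" using out_eq BD(1)[OF z(2)] by blast
  have "v \<noteq> z" "w \<noteq> z" "u \<noteq> w" using z w irrefl BD by blast+
  then have "E `` {u} - {w} \<noteq> E `` {w} - {u}" using w(1) out_w \<open>v \<noteq> w\<close> by blast
  then obtain y where y: "E `` {y} = {u, w}" using double[of u w] w(1) out_w by blast
  have "y \<noteq> w" "y \<noteq> v" using y irrefl assms(2) by blast+
  then have yu: "(u, y) \<notin> E" using w(1) by blast
  show False
  proof (cases "(y, u) \<in> B")
    case True
    then obtain q where "E `` {y} = {u, q}" "(u, q) \<in> B" using pred by blast
    then have "(u, w) \<in> B" using y \<open>u \<noteq> w\<close> by (metis doubleton_eq_iff)
    then show False using BD(2) out_w by blast
  next
    case False
    then obtain t where "E `` {t} = {y, u}" "E `` {y} = {t, u}" using BI[of y u] y yu by blast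
    then have "E `` {w} = {y, u}" using y \<open>u \<noteq> w\<close> by (metis doubleton_eq_iff)
    then have "y = z" using out_w \<open>z \<noteq> u\<close> by (metis doubleton_eq_iff)
    then show False using y BD(2)[OF z(2)] by blast
  qed
qed

text \<open>The vertices are listed in the order of the numbering of the obstruction.\<close>
lemma closed_copy_K3:
  assumes "distinct [a, b, c]" "E `` {a} = {b, c}" "E `` {b} = {a, c}" "E `` {c} = {a, b}"
  shows "closed_copy K3 E"
  unfolding closed_copy_def
  by (rule exI[of _ "(\<lambda>_. undefined)(1 := a, 2 := b, 3 := c)"])
    (use assms in \<open>auto simp: K3_def inj_on_def Image_def\<close>)

lemma closed_copy_N4:
  assumes "distinct [a, b, c, d]"
    "E `` {a} = {b, c}" "E `` {b} = {a, c}" "E `` {c} = {b, d}" "E `` {d} = {c, b}"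
  shows "closed_copy N4 E"
  unfolding closed_copy_def
  by (rule exI[of _ "(\<lambda>_. undefined)(1 := a, 2 := b, 3 := c, 4 := d)"])
    (use assms in \<open>auto simp: N4_def inj_on_def Image_def\<close>)

lemma closed_copy_M5:
  assumes "distinct [a, b, c, d, e]" "E `` {a} = {b, c}" "E `` {b} = {a, c}"
    "E `` {c} = {b, d}" "E `` {d} = {c, e}" "E `` {e} = {d, c}"
  shows "closed_copy M5 E"
  unfolding closed_copy_def
  by (rule exI[of _ "(\<lambda>_. undefined)(1 := a, 2 := b, 3 := c, 4 := d, 5 := e)"])
    (use assms in \<open>auto simp: M5_def inj_on_def Image_def\<close>)

lemma closed_copy_K3_if_sym:
  assumes "sym E" "E \<noteq> {}"
  shows "closed_copy K3 E"
proof -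
  have sym: "(y, x) \<in> E" if "(x, y) \<in> E" for x y using that assms(1) by (auto dest: symD)
  obtain u v where uv: "(u, v) \<in> E" using assms(2) by auto
  obtain a where a: "E `` {u} = {v, a}" "a \<noteq> v" "a \<noteq> u" "u \<noteq> v" using uv by (elim outE) auto
  obtain b where b: "E `` {v} = {u, b}" "b \<noteq> v" "b \<noteq> u" using sym[OF uv] by (elim outE) auto
  have "a = b"
    using double[OF uv sym[OF uv]]
  proof
    assume "\<exists>x. E `` {x} = {u, v}"
    then obtain x where x: "E `` {x} = {u, v}" ..
    then have "(u, x) \<in> E" "(v, x) \<in> E" using sym by blast+
    moreover have "x \<noteq> u" "x \<noteq> v" using x irrefl by blast+
    ultimately show "a = b" using a b by blast
  qed (use a b in auto)
  then have "E `` {a} = {u, v}" using a b sym by (intro out_eq) auto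
  then show ?thesis using closed_copy_K3[of u v a] a b \<open>a = b\<close> by auto
qed

text \<open>
  Take an arc \<open>(u, v)\<close> without reverse and its partner \<open>x\<close>. If \<open>v\<close> had no arc back to \<open>x\<close>, then
  \<open>twin\<close> would give a vertex \<open>y\<close> with an arc into \<open>{u, x}\<close>, whose own partner has nowhere to be.
  Hence \<open>x \<leftrightarrow> v\<close>, and the path \<open>u, x, v\<close> is continued by two-way arcs to \<open>y\<close> and, if \<open>N4\<close>
  has not appeared, to \<open>z\<close>. It cannot go on beyond \<open>z\<close>, because then contracting
  the 2-cycle of \<open>v\<close> and \<open>y\<close> would be possible.
\<close>
lemma critical_closed_copy:
  assumes "E \<noteq> {}"
  shows "closed_copy K3 E \<or> closed_copy N4 E \<or> closed_copy M5 E"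
proof (cases "sym E")
  case False
  then obtain u v where uv: "(u, v) \<in> E" "(v, u) \<notin> E" by (auto simp: sym_def)
  then obtain x where x: "E `` {x} = {u, v}" "E `` {u} = {x, v}" using partner by blast
  have ne: "u \<noteq> v" "x \<noteq> u" "x \<noteq> v" using x irrefl by blast+
  have vx: "(v, x) \<in> E"
  proof (rule ccontr)
    assume vx: "(v, x) \<notin> E"
    then obtain y where y: "y \<notin> {u, x, v}" "E `` {y} \<noteq> {}" "E `` {y} \<subseteq> {u, x, v}"
      using twin[of u x v] x uv by blast
    then obtain r where "(y, r) \<in> E" by blast
    then obtain r' where "E `` {y} = {r, r'}" "r' \<noteq> r" by (rule outE)
    then have "(y, u) \<in> E \<or> (y, x) \<in> E" using y(3) by auto
    then show False
    proof
      assume "(y, u) \<in> E"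
      moreover have "(u, y) \<notin> E" using x y by auto
      ultimately obtain p where p: "E `` {p} = {y, u}" "E `` {y} = {p, u}" using partner by blast
      have "p \<noteq> u" using p irrefl by blast
      then have "p \<in> {x, v}" using p y by blast
      then show False using p x y uv by blast
    next
      assume "(y, x) \<in> E"
      moreover have "(x, y) \<notin> E" using x y by auto
      ultimately obtain p where p: "E `` {p} = {y, x}" "E `` {y} = {p, x}" using partner by blast
      have "p \<noteq> x" using p irrefl by blast
      then have "p \<in> {u, v}" using p y by blast
      then show False using p x y vx by blast
    qed
  qed
  then obtain y where y: "E `` {v} = {x, y}" "y \<noteq> x" "y \<noteq> v" by (rule outE)
  have "y \<noteq> u" using y uv by blast
  have yv: "(y, v) \<in> E"
  proof (rule ccontr)
    assume "(y, v) \<notin> E"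
    then obtain z where "E `` {z} = {v, y}" "E `` {v} = {z, y}" using partner[of v y] y by blast
    then have "E `` {x} = {v, y}" using y by (metis doubleton_eq_iff)
    then show False using x \<open>y \<noteq> u\<close> y by (metis doubleton_eq_iff)
  qed
  then obtain z where z: "E `` {y} = {v, z}" "z \<noteq> v" "z \<noteq> y" by (rule outE)
  show ?thesis
  proof (cases "(z, y) \<in> E")
    case False
    then obtain p where "E `` {p} = {y, z}" "E `` {y} = {p, z}" using partner[of y z] z by blast
    then have "E `` {v} = {y, z}" using z by (metis doubleton_eq_iff)
    then have "z = x" using y by (metis doubleton_eq_iff)
    then show ?thesis
      using closed_copy_N4[of u x v y] x y z ne \<open>y \<noteq> u\<close> by auto
  next
    case True
    have "z \<noteq> u" "z \<noteq> x" using True x y \<open>y \<noteq> u\<close> by blast+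
    obtain w where w: "E `` {z} = {y, w}" "w \<noteq> y" using True by (rule outE)
    have "w \<noteq> z" using w irrefl by blast
    show ?thesis
    proof (cases "w = v")
      case True
      then show ?thesis
        using closed_copy_M5[of u x v y z] x y z w ne \<open>y \<noteq> u\<close> \<open>z \<noteq> u\<close> \<open>z \<noteq> x\<close> by auto
    next
      case False
      \<comment> \<open>The path would go on to \<open>t\<close>; contracting \<open>v\<close> and \<open>y\<close> rules this out.\<close>
      have "E `` {y} - {z} \<noteq> E `` {z} - {y}" using z w False by blast
      then obtain t where t: "E `` {t} = {y, z}" using double[of y z] z w by blast
      have "t \<noteq> z" "t \<noteq> v" using t y z \<open>z \<noteq> x\<close> irrefl by blast+
      then have "(y, t) \<notin> E" using z by blast
      then obtain p where "E `` {p} = {t, y}" "E `` {t} = {p, y}" using partner[of t y] t by blast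
      then have "E `` {z} = {t, y}" using t z by (metis doubleton_eq_iff)
      have "E `` {v} - {y} \<noteq> E `` {y} - {v}" using y z \<open>z \<noteq> x\<close> by blast
      then obtain s where s: "E `` {s} = {v, y}" using double[of v y] y z by blast
      have "s \<noteq> v" "s \<noteq> z" using s \<open>E `` {z} = {t, y}\<close> \<open>t \<noteq> v\<close> y irrefl by blast+
      then have "(y, s) \<notin> E" using z by blast
      then obtain p where "E `` {p} = {s, y}" "E `` {s} = {p, y}" using partner[of s y] s by blast
      then have "E `` {v} = {s, y}" using s y by (metis doubleton_eq_iff)
      then have "s = x" using y by (metis doubleton_eq_iff)
      then show ?thesis using s x \<open>y \<noteq> u\<close> y(3) by (metis doubleton_eq_iff)
    qed
  qed
qed (use closed_copy_K3_if_sym assms in blast)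

end

section \<open>Minimal non-eliminable digraphs are critical\<close>
lemma eliminable_first:
  assumes "eliminable V E" "V \<noteq> {}"
  obtains v w where "v \<in> V" "V \<inter> E `` {v} \<subseteq> {v, w}"
  using assms by (cases rule: eliminable.cases) auto

lemma minimal_not_eliminable:
  assumes "pair_digraph G" "\<not> eliminable (pverts G) (parcs G)"
  obtains M where "minor_step\<^sup>*\<^sup>* G M" "\<not> eliminable (pverts M) (parcs M)"
    "\<And>M'. minor_step\<^sup>*\<^sup>* M M' \<Longrightarrow> card (pverts M') < card (pverts M) \<Longrightarrow> eliminable (pverts M') (parcs M')"
    "\<And>e. e \<in> parcs M \<Longrightarrow> eliminable (pverts M) (parcs M - {e})"
proof -
  define P where "P M \<longleftrightarrow> minor_step\<^sup>*\<^sup>* G M \<and> \<not> eliminable (pverts M) (parcs M)" for M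
  have "P G" using assms by (simp add: P_def)
  then obtain M0 where M0: "P M0" "\<And>M. P M \<Longrightarrow> card (pverts M0) \<le> card (pverts M)"
    using ex_has_least_nat[of P G "\<lambda>M. card (pverts M)"] by blast
  let ?Q = "\<lambda>M. P M \<and> card (pverts M) = card (pverts M0)"
  obtain M where M: "?Q M" "\<And>M'. ?Q M' \<Longrightarrow> card (parcs M) \<le> card (parcs M')"
    using ex_has_least_nat[of ?Q M0 "\<lambda>M. card (parcs M)"] M0(1) by blast
  show ?thesis
  proof (rule that)
    show "minor_step\<^sup>*\<^sup>* G M" "\<not> eliminable (pverts M) (parcs M)" using M(1) by (auto simp: P_def)
  next
    fix M' assume "minor_step\<^sup>*\<^sup>* M M'" "card (pverts M') < card (pverts M)"
    then show "eliminable (pverts M') (parcs M')"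
      using M0(2)[of M'] M(1) unfolding P_def by (metis leD rtranclp_trans)
  next
    fix e assume e: "e \<in> parcs M"
    then have "minor_step\<^sup>*\<^sup>* G (delete_edge M e)"
      using M(1) minor_step.delete_edge[OF e] by (auto simp: P_def intro: rtranclp.rtrancl_into_rtrancl)
    moreover have "finite (parcs M)"
      using minor_steps_pair_digraph[of G M] M(1) assms(1)
      by (auto simp: P_def pair_digraph_def pair_fin_digraph_def pair_fin_digraph_axioms_def)
    then have "card (parcs (delete_edge M e)) < card (parcs M)"
      using card_Diff1_less[of "parcs M" e] e by (simp only: delete_edge_def pair_pre_digraph.simps)
    ultimately have "eliminable (pverts (delete_edge M e)) (parcs (delete_edge M e))"
      using M(2)[of "delete_edge M e"] M(1) by (fastforce simp: P_def delete_edge_def)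
    then show "eliminable (pverts M) (parcs M - {e})" by (simp add: delete_edge_def)
  qed
qed

text \<open>
  Minimality is split into two parts, few vertices first and then few arcs, so that
  the number of arcs after a contraction need not be estimated.
\<close>
locale minimal_digraph = pair_digraph M for M :: "'a pair_pre_digraph" +
  assumes not_eliminable: "\<not> eliminable (pverts M) (parcs M)"
    and fewer_verts: "minor_step\<^sup>*\<^sup>* M M' \<Longrightarrow> card (pverts M') < card (pverts M) \<Longrightarrow>
      eliminable (pverts M') (parcs M')"
    and fewer_arcs: "e \<in> parcs M \<Longrightarrow> eliminable (pverts M) (parcs M - {e})"
begin

lemma no_loop: "(v, v) \<notin> parcs M"
  using pair_no_loops by fastforce

lemma cycle_2:
  assumes "(u, v) \<in> parcs M" "(v, u) \<in> parcs M"
  shows "pre_digraph.cycle (with_proj M) [(u, v), (v, u)]"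
  using assms no_loop in_arcsD1
  unfolding pre_digraph.cycle_def pre_digraph.awalk_def cas_with_proj_eq awalk_verts_with_proj_eq
  by (intro exI[of _ u]) auto

text \<open>
  The form in which minimality is used below: a contraction of \<open>M\<close> leaves some vertex \<open>v\<close> with at
  most one out-neighbour, which tells how the out-neighbours of \<open>v\<close> in \<open>M\<close> were affected.
\<close>
lemma few_out_if_fewer_verts:
  assumes "minor_step\<^sup>*\<^sup>* M M'" "pverts M' \<subset> pverts M" "pverts M' \<noteq> {}"
  obtains v w where "v \<in> pverts M'" "pverts M' \<inter> parcs M' `` {v} \<subseteq> {v, w}"
  using fewer_verts[OF assms(1)] assms pair_finite_verts by (meson psubset_card_mono eliminable_first)

text \<open>
  Otherwise, out-contracting the unique arc leaving \<open>v\<close>, or deleting \<open>v\<close> if there is none, is an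
  elimination step, and its result is eliminable by minimality.
\<close>
lemma at_least_two:
  assumes "v \<in> pverts M"
  shows "\<not> parcs M `` {v} \<subseteq> {w}"
proof
  assume *: "parcs M `` {v} \<subseteq> {w}"
  have card: "card (pverts M - {v}) < card (pverts M)"
    using assms pair_finite_verts by (intro card_Diff1_less)
  have "eliminable (pverts M - {v}) (bypass v (parcs M))"
  proof (cases "(v, w) \<in> parcs M")
    case True
    have "eliminable (pverts (out_contract M v w)) (parcs (out_contract M v w))"
      by (rule fewer_verts[OF r_into_rtranclp[where r = minor_step, OF minor_step.out_contraction[OF True]]])
        (use card in \<open>simp add: out_contract_def\<close>)
    then show ?thesis
      by (rule eliminable_mono) (use * in \<open>auto simp: out_contract_def in_bypass\<close>)
  next
    case False
    have "eliminable (pverts (delete_vertex M v)) (parcs (delete_vertex M v))"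
      by (rule fewer_verts[OF r_into_rtranclp[where r = minor_step, OF minor_step.delete_vertex[OF assms]]])
        (use card in \<open>simp add: delete_vertex_def\<close>)
    then show ?thesis
      by (rule eliminable_mono) (use * False in \<open>auto simp: delete_vertex_def in_bypass\<close>)
  qed
  then have "eliminable (pverts M) (parcs M)"
    using assms * by (elim eliminable.eliminate[where w = w, rotated 2]) auto
  then show False using not_eliminable by contradiction
qed

text \<open>
  Otherwise, an arc could be deleted from \<open>M\<close> such that all vertices keep two out-neighbours.
\<close>
lemma exactly_two:
  assumes "(u, v) \<in> parcs M"
  shows "\<exists>w. w \<noteq> v \<and> parcs M `` {u} = {v, w}"
proof -
  have "u \<in> pverts M" using assms by (rule in_arcsD1)
  then obtain w where w: "(u, w) \<in> parcs M" "w \<noteq> v" using at_least_two[of u v] by blast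
  have "y = v \<or> y = w" if y: "(u, y) \<in> parcs M" for y
  proof (rule ccontr)
    assume "\<not> ?thesis"
    have "branching (pverts M) (parcs M - {(u, y)})"
      unfolding branching_def
    proof (intro conjI ballI)
      fix x assume x: "x \<in> pverts M"
      have "\<exists>a b. a \<noteq> b \<and> (x, a) \<in> parcs M - {(u, y)} \<and> (x, b) \<in> parcs M - {(u, y)}"
      proof (cases "x = u")
        case True
        then show ?thesis using assms w \<open>\<not> (y = v \<or> y = w)\<close> by blast
      next
        case False
        obtain a where "(x, a) \<in> parcs M" using at_least_two[OF x] by blast
        moreover then obtain b where "(x, b) \<in> parcs M" "b \<noteq> a" using at_least_two[OF x, of a] by blast
        ultimately show ?thesis using False by blast
      qed
      then show "\<exists>a \<in> pverts M. \<exists>b \<in> pverts M. a \<noteq> b \<and> a \<noteq> x \<and> b \<noteq> x \<and>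
          (x, a) \<in> parcs M - {(u, y)} \<and> (x, b) \<in> parcs M - {(u, y)}"
        using in_arcsD2 no_loop by blast
    qed (use \<open>u \<in> pverts M\<close> in blast)
    then show False using branching_not_eliminable fewer_arcs[OF y] by blast
  qed
  then show ?thesis using assms w by blast
qed

lemma out_pair:
  assumes "x \<in> pverts M"
  obtains a b where "parcs M `` {x} = {a, b}" "a \<noteq> b" "a \<noteq> x" "b \<noteq> x" "a \<in> pverts M" "b \<in> pverts M"
proof -
  obtain a where "(x, a) \<in> parcs M" using at_least_two[OF assms] by blast
  with exactly_two that show ?thesis using no_loop in_arcsD2 by blast
qed

text \<open>
  Out-contracting \<open>(u, v)\<close> redirects the arcs entering \<open>u\<close> to \<open>v\<close>. Apart from \<open>v\<close>, which has no
  arc to \<open>u\<close>, a vertex loses an out-neighbour only if both were \<open>u\<close> and \<open>v\<close>.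
\<close>
lemma single_arc:
  assumes "(u, v) \<in> parcs M" "(v, u) \<notin> parcs M"
  shows "\<exists>x. parcs M `` {x} = {u, v}"
proof -
  let ?M = "out_contract M u v"
  have uv: "u \<in> pverts M" "v \<in> pverts M" "u \<noteq> v"
    using assms(1) in_arcsD1 in_arcsD2 no_loop by blast+
  have "minor_step\<^sup>*\<^sup>* M ?M" using assms(1) by (auto intro: minor_step.intros)
  then obtain x w where x: "x \<in> pverts ?M" "pverts ?M \<inter> parcs ?M `` {x} \<subseteq> {x, w}"
    by (rule few_out_if_fewer_verts) (use uv in \<open>auto simp: out_contract_def\<close>)
  then have xM: "x \<in> pverts M" "x \<noteq> u" by (auto simp: out_contract_def)
  obtain a b where ab: "parcs M `` {x} = {a, b}" "a \<noteq> b" "a \<noteq> x" "b \<noteq> x" "a \<in> pverts M" "b \<in> pverts M"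
    using out_pair[OF xM(1)] .
  have "y \<in> {x, w}" if "(x, y) \<in> parcs M" "y \<noteq> u" for y
    using x(2) that xM in_arcsD2 no_loop by (auto simp: out_contract_def)
  moreover have "v \<in> {x, w}" if "(x, u) \<in> parcs M"
    using x(2) that xM uv by (auto simp: out_contract_def)
  moreover have "x \<noteq> v" if "(x, u) \<in> parcs M" using that assms(2) by blast
  ultimately have "{a, b} = {u, v}" using ab by blast
  then show ?thesis using ab(1) by auto
qed

text \<open>
  Contracting the 2-cycle on \<open>u\<close> and \<open>v\<close> leaves a vertex with fewer than two out-neighbours: either
  the contracted one, whose out-neighbours are the remaining ones of \<open>u\<close> and of \<open>v\<close>, or some
  vertex with out-neighbours \<open>u\<close> and \<open>v\<close>.
\<close>
lemma double_arc:
  assumes "(u, v) \<in> parcs M" "(v, u) \<in> parcs M"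
  shows "(\<exists>x. parcs M `` {x} = {u, v}) \<or> parcs M `` {u} - {v} = parcs M `` {v} - {u}"
proof (rule disjCI)
  assume ne: "parcs M `` {u} - {v} \<noteq> parcs M `` {v} - {u}"
  let ?M = "contract_set M {u, v} u"
  have uv: "u \<in> pverts M" "v \<in> pverts M" "u \<noteq> v"
    using assms(1) in_arcsD1 in_arcsD2 no_loop by blast+
  have "minor_step M ?M"
    by (rule minor_step.cycle_contraction[OF cycle_2[OF assms]]) auto
  then have "minor_step\<^sup>*\<^sup>* M ?M" by blast
  then obtain x w where x: "x \<in> pverts ?M" "pverts ?M \<inter> parcs ?M `` {x} \<subseteq> {x, w}"
    by (rule few_out_if_fewer_verts) (use uv in \<open>force simp: contract_set_def\<close>)+
  then have xM: "x \<in> pverts M" "x \<noteq> v" using uv by (auto simp: contract_set_def)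
  have "x \<noteq> u"
  proof
    assume "x = u"
    obtain a where a: "parcs M `` {u} = {v, a}" "a \<noteq> v" using exactly_two[OF assms(1)] by blast
    obtain b where b: "parcs M `` {v} = {u, b}" "b \<noteq> u" using exactly_two[OF assms(2)] by blast
    have "y \<in> {u, w}" if "(u, y) \<in> parcs M \<or> (v, y) \<in> parcs M" "y \<notin> {u, v}" for y
    proof -
      have "y \<in> pverts M" using that(1) in_arcsD2 by blast
      then show ?thesis using that x(2) \<open>x = u\<close> by (auto simp: contract_set_def)
    qed
    moreover have "a \<noteq> u" "b \<noteq> v" using a b no_loop by blast+
    ultimately have "a = w" "b = w" using a b by blast+
    then show False using a b ne by auto
  qed
  obtain a b where ab: "parcs M `` {x} = {a, b}" "a \<noteq> b" "a \<noteq> x" "b \<noteq> x" "a \<in> pverts M" "b \<in> pverts M"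
    using out_pair[OF xM(1)] .
  have "y \<in> {x, w}" if "(x, y) \<in> parcs M" "y \<notin> {u, v}" for y
    using x(2) that xM \<open>x \<noteq> u\<close> in_arcsD2 by (auto simp: contract_set_def)
  moreover have "u \<in> {x, w}" if "(x, u) \<in> parcs M \<or> (x, v) \<in> parcs M"
    using x(2) that xM \<open>x \<noteq> u\<close> by (auto simp: contract_set_def)
  ultimately have "{a, b} = {u, v}" using ab \<open>x \<noteq> u\<close> by blast
  then show "\<exists>x. parcs M `` {x} = {u, v}" using ab(1) by auto
qed

text \<open>
  Out-contracting \<open>(u, v)\<close> and then \<open>(v, a)\<close> moves all arcs entering \<open>u\<close> or \<open>v\<close> to \<open>a\<close>. A vertex
  that drops below two out-neighbours is \<open>a\<close>, if it has an arc to \<open>u\<close> or \<open>v\<close>, or a vertex both of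
  whose out-neighbours are among \<open>u\<close>, \<open>v\<close>, \<open>a\<close>.
\<close>
lemma twin_arcs:
  assumes "parcs M `` {u} = {v, a}" "parcs M `` {v} = {u, a}"
  shows "(a, u) \<in> parcs M \<or> (a, v) \<in> parcs M \<or>
    (\<exists>x. x \<notin> {u, v, a} \<and> parcs M `` {x} \<noteq> {} \<and> parcs M `` {x} \<subseteq> {u, v, a})"
proof -
  let ?M1 = "out_contract M u v"
  let ?M = "out_contract ?M1 v a"
  have arcs: "(u, v) \<in> parcs M" "(v, a) \<in> parcs M" "(u, a) \<in> parcs M" using assms by blast+
  have uva: "u \<in> pverts M" "v \<in> pverts M" "a \<in> pverts M" "u \<noteq> v" "a \<noteq> u" "a \<noteq> v"
    using arcs in_arcsD1 in_arcsD2 no_loop by blast+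
  have "minor_step M ?M1" using arcs by (intro minor_step.out_contraction)
  moreover have "minor_step ?M1 ?M"
    by (rule minor_step.out_contraction) (use arcs uva in \<open>auto simp: out_contract_def\<close>)
  ultimately have steps: "minor_step\<^sup>*\<^sup>* M ?M" by simp
  have verts: "pverts ?M = pverts M - {u, v}" by (auto simp: out_contract_def)
  obtain x w where x: "x \<in> pverts ?M" "pverts ?M \<inter> parcs ?M `` {x} \<subseteq> {x, w}"
    using few_out_if_fewer_verts[OF steps] uva verts by blast
  then have xM: "x \<in> pverts M" "x \<noteq> u" "x \<noteq> v" using verts by auto
  obtain p q where pq: "parcs M `` {x} = {p, q}" "p \<noteq> q" "p \<noteq> x" "q \<noteq> x" "p \<in> pverts M" "q \<in> pverts M"
    using out_pair[OF xM(1)] .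
  have keep: "y \<in> {x, w}" if "(x, y) \<in> parcs M" "y \<notin> {u, v}" for y
    using x(2) that xM in_arcsD2[OF that(1)] no_loop[of x] by (auto simp: out_contract_def)
  have move: "a \<in> {x, w}" if "(x, u) \<in> parcs M \<or> (x, v) \<in> parcs M"
    using x(2) that xM uva by (auto simp: out_contract_def)
  show ?thesis
  proof (cases "x = a")
    case True
    then have "(a, u) \<in> parcs M \<or> (a, v) \<in> parcs M" using keep pq by blast
    then show ?thesis by blast
  next
    case False
    have "{p, q} \<subseteq> {u, v, a}" using keep move pq False by blast
    then show ?thesis using pq(1) xM False by auto
  qed
qed

sublocale critical_relation "parcs M"
  using pair_finite_arcs no_loop exactly_two single_arc double_arc twin_arcs
  by (rule critical_relation.intro)

lemma has_arc: "parcs M \<noteq> {}"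
proof -
  have "pverts M \<noteq> {}" using not_eliminable by (auto intro: eliminable.empty)
  then show ?thesis using at_least_two by blast
qed

end

section \<open>The characterisation\<close>
lemma pair_digraph_obstructions:
  "pair_digraph K3" "pair_digraph N4" "pair_digraph M5"
  by (auto simp: pair_digraph_iff K3_def N4_def M5_def)

lemma branching_obstructions:
  "branching (pverts K3) (parcs K3)" "branching (pverts N4) (parcs N4)"
  "branching (pverts M5) (parcs M5)"
  by (auto simp: branching_def K3_def N4_def M5_def)

theorem theorem20:
  fixes G :: "'a pair_pre_digraph"
  assumes "pair_digraph G"
  shows "partial_k_dag 1 G \<longleftrightarrow>
    \<not> directed_minor K3 G \<and> \<not> directed_minor N4 G \<and> \<not> directed_minor M5 G"
proof
  assume "partial_k_dag 1 G"
  then have "eliminable (pverts G) (parcs G)" using partial_k_dag_iff_eliminable[OF assms] by simp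
  then show "\<not> directed_minor K3 G \<and> \<not> directed_minor N4 G \<and> \<not> directed_minor M5 G"
    using branching_not_minor pair_digraph_obstructions branching_obstructions assms by blast
next
  assume free: "\<not> directed_minor K3 G \<and> \<not> directed_minor N4 G \<and> \<not> directed_minor M5 G"
  show "partial_k_dag 1 G"
  proof (rule ccontr)
    assume "\<not> partial_k_dag 1 G"
    then have "\<not> eliminable (pverts G) (parcs G)"
      using partial_k_dag_iff_eliminable[OF assms] by simp
    then obtain M where M: "minor_step\<^sup>*\<^sup>* G M" "\<not> eliminable (pverts M) (parcs M)"
      "\<And>M'. minor_step\<^sup>*\<^sup>* M M' \<Longrightarrow> card (pverts M') < card (pverts M) \<Longrightarrow>
        eliminable (pverts M') (parcs M')"
      "\<And>e. e \<in> parcs M \<Longrightarrow> eliminable (pverts M) (parcs M - {e})"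
      using minimal_not_eliminable[OF assms] by metis
    have pair: "pair_digraph M" using minor_steps_pair_digraph[OF M(1) assms] .
    then interpret minimal_digraph M
      using M by (intro minimal_digraph.intro minimal_digraph_axioms.intro)
    have "directed_minor K M"
      if "closed_copy K (parcs M)" "K \<in> {K3, N4, M5}" for K
      by (rule closed_copy_minor[OF that(1) pair])
        (use that(2) pair_digraph_obstructions in \<open>auto simp: K3_def N4_def M5_def\<close>)
    then have "directed_minor K3 M \<or> directed_minor N4 M \<or> directed_minor M5 M"
      using critical_closed_copy[OF has_arc] by blast
    then have "directed_minor K3 G \<or> directed_minor N4 G \<or> directed_minor M5 G"
      using M(1) unfolding directed_minor_def by (meson rtranclp_trans)
    then show False using free by blast
  qed
qed

end
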